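(* Let $f:\Gamma\twoheadrightarrow\Delta$ be a surjective homomorphism of ordered groups (i.e. an order-preserving group homomorphism: $\gamma_1\le\gamma_2\Rightarrow f(\gamma_1)\le f(\gamma_2)$) between divisible totally ordered abelian groups $\Gamma$ and $\Delta$, and let $\Delta'\subseteq\Gamma$ be a subgroup. The following are equivalent: (i) The restriction $f|_{\Delta'}:\Delta'\to\Delta$ is an isomorphism of ordered groups; in particular $(f|_{\Delta'})^{-1}:\Delta\hookrightarrow\Gamma$ is a cross-section of $f$ (i.e. $f\circ (f|_{\Delta'})^{-1}=\mathrm{id}_\Delta$). (ii) $\Delta'$ is divisible, tame and cofinal in $\Gamma$, and $\ker(f)=\{\gamma\in\Gamma\mid \mathrm{st}(\gamma)=0\}$, where $\mathrm{st}=\mathrm{st}^{\Gamma}_{\Delta'}:\Gamma\to\Delta'$ is the standard part map of the tame pair $\Delta'\subseteq\Gamma$. (iii) $\Delta'$ is divisible, tame and cofinal in $\Gamma$, and for all $\gamma\in\Gamma$: $f(\gamma)\ge 0$ if and only if $\mathrm{st}(\gamma)\ge 0$. Moreover, if any of (i)–(iii) holds, then $\Delta'$ is divisible, tame and cofinal in $\Gamma$; for every $\gamma\in\Gamma$, $\mathrm{st}(\gamma)$ is the unique element of $\Delta'$ with $f(\mathrm{st}(\gamma))=f(\gamma)$; and the standard part map $\mathrm{st}:\Gamma\twoheadrightarrow\Delta'$ is a surjective order-preserving group homomorphism with $\mathrm{st}|_{\Delta'}=\mathrm{id}_{\Delta'}$ (a retract of the extension $\Delta'\subseteq\Gamma$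).
   Context: All groups are abelian and written additively; an $o$-group is a totally ordered abelian group, ordered subgroups carry the induced order. For an extension $A\subseteq B$ of dense linear orders without endpoints, $\mathrm{c.h.}_B(A)=\{b\in B\mid \exists a_1,a_2\in A,\ a_1\le b\le a_2\}$. $A$ is tame in $B$ if for every $b\in\mathrm{c.h.}_B(A)$ there is $a\in A$ such that either $b=a$, or $b<a$ and there is no $a'\in A$ with $b<a'<a$, or $a<b$ and there is no $a'\in A$ with $a<a'<b$. In that case such $a$ is unique, and the standard part map $\mathrm{st}^B_A:\mathrm{c.h.}_B(A)\to A$ sends $b$ to this unique $a$. $A$ is cofinal in $B$ if for every $b\in B$ there is $a\in A$ with $b\le a$ (so that, for groups, $\mathrm{c.h.}_B(A)=B$ and $\mathrm{st}$ is defined on all of $B$).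
   Formalization: The group Δ is assumed to be nonzero; for Δ = 0, Δ' = 0 and Γ nonzero, (i) holds but Δ' is not cofinal in Γ, so (ii), (iii) and the final claims fail. *)

theory Defs
  imports Main
begin

definition add_subgroup :: "'a::ab_group_add set \<Rightarrow> bool" where
  "add_subgroup H \<longleftrightarrow> 0 \<in> H \<and> (\<forall>x\<in>H. \<forall>y\<in>H. x + y \<in> H) \<and> (\<forall>x\<in>H. - x \<in> H)"

(* The constant sum is the n-fold multiple n y. *)
definition divisible_set :: "'a::ab_group_add set \<Rightarrow> bool" where
  "divisible_set H \<longleftrightarrow> (\<forall>n::nat. n \<ge> 1 \<longrightarrow> (\<forall>x\<in>H. \<exists>y\<in>H. (\<Sum>i<n. y) = x))"

(* Homomorphisms and isomorphisms between ordered groups carried by subgroups A and B with the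
   induced order. Only the values of f on A matter. *)
definition ogroup_hom ::
  "'a::linordered_ab_group_add set \<Rightarrow> 'b::linordered_ab_group_add set \<Rightarrow> ('a \<Rightarrow> 'b) \<Rightarrow> bool" where
  "ogroup_hom A B f \<longleftrightarrow>
     f ` A \<subseteq> B \<and> (\<forall>x\<in>A. \<forall>y\<in>A. f (x + y) = f x + f y) \<and> mono_on A f"

definition ogroup_iso ::
  "'a::linordered_ab_group_add set \<Rightarrow> 'b::linordered_ab_group_add set \<Rightarrow> ('a \<Rightarrow> 'b) \<Rightarrow> bool" where
  "ogroup_iso A B f \<longleftrightarrow>
     ogroup_hom A B f \<and> bij_betw f A B \<and> ogroup_hom B A (inv_into A f)"

(* For an extension A <= B of orders, B is the whole type from here on. A and B are meant to be dense
   without endpoints; for divisible ordered groups this amounts to being nonzero. *)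
definition order_hull :: "'a::linorder set \<Rightarrow> 'a set" where
  "order_hull A = {b. \<exists>a1\<in>A. \<exists>a2\<in>A. a1 \<le> b \<and> b \<le> a2}"

definition is_standard_part :: "'a::linorder set \<Rightarrow> 'a \<Rightarrow> 'a \<Rightarrow> bool" where
  "is_standard_part A b a \<longleftrightarrow> a \<in> A \<and>
     (b = a \<or>
      (b < a \<and> \<not> (\<exists>a'\<in>A. b < a' \<and> a' < a)) \<or>
      (a < b \<and> \<not> (\<exists>a'\<in>A. a < a' \<and> a' < b)))"

definition tame :: "'a::linorder set \<Rightarrow> bool" where
  "tame A \<longleftrightarrow> (\<forall>b\<in>order_hull A. \<exists>a. is_standard_part A b a)"

(* Meaningful for b in order_hull A when A is tame and densely ordered, so that a is unique. *)
definition st :: "'a::linorder set \<Rightarrow> 'a \<Rightarrow> 'a" where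
  "st A b = (THE a. is_standard_part A b a)"

definition cofinal_in :: "'a::linorder set \<Rightarrow> bool" where
  "cofinal_in A \<longleftrightarrow> (\<forall>b. \<exists>a\<in>A. b \<le> a)"

end

theory Submission
  imports Defs
begin

text \<open>
  In a densely ordered set the standard part of an element is unique, so in a divisible subgroup it
  commutes with negation and with translation by elements of the subgroup. If \<open>f\<close> maps \<open>\<Delta>'\<close>
  bijectively onto \<open>\<Delta>\<close>, no element of \<open>\<Delta>'\<close> lies strictly between \<open>\<gamma>\<close> and the element \<open>\<delta>\<close> of \<open>\<Delta>'\<close>
  with the same image, because \<open>f\<close> would identify it with \<open>\<delta>\<close>; hence \<open>st \<gamma> = \<delta>\<close>. Conversely, if the
  kernel is \<open>{\<gamma>. st \<gamma> = 0}\<close>, then \<open>\<gamma> - st \<gamma>\<close> lies in it, which makes \<open>f\<close> surjective on \<open>\<Delta>'\<close>.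
\<close>

section \<open>Standard parts relative to dense sets and divisible subgroups\<close>

lemma is_standard_part_iff:
  "is_standard_part A b a \<longleftrightarrow>
     a \<in> A \<and> (\<forall>x\<in>A. \<not> (b < x \<and> x < a) \<and> \<not> (a < x \<and> x < b))"
  \<comment> \<open>At most one of the two open intervals between \<open>a\<close> and
    \<open>b\<close> is nonempty, so the three cases merge into one condition symmetric in the two
    sides.\<close>
  unfolding is_standard_part_def by (metis less_asym' less_linear less_trans)

lemma is_standard_part_unique:
  assumes dense: "\<And>a b. a \<in> A \<Longrightarrow> b \<in> A \<Longrightarrow> a < b \<Longrightarrow> \<exists>c\<in>A. a < c \<and> c < b"
    and "is_standard_part A b a1" "is_standard_part A b a2"
  shows "a1 = a2"
proof -
  have "\<not> a1 < a2" if "is_standard_part A b a1" "is_standard_part A b a2" for a1 a2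
  proof
    assume "a1 < a2"
    moreover have A: "a1 \<in> A" "a2 \<in> A"
      using that by (auto simp: is_standard_part_iff)
    ultimately obtain c where c: "c \<in> A" "a1 < c" "c < a2"
      using dense by blast
    \<comment> \<open>A single point \<open>c\<close> leaves the case \<open>b = c\<close> open.
      With two points, \<open>a1\<close> being a standard part forces \<open>b \<le> c'\<close>,
      while \<open>a2\<close> being one forces \<open>c \<le> b\<close>, against
      \<open>c' < c\<close>.\<close>
    obtain c' where c': "c' \<in> A" "a1 < c'" "c' < c"
      using dense c A by blast
    show False
      using that c c' unfolding is_standard_part_iff
      by (metis less_linear less_trans)
  qed
  with assms(2,3) show ?thesis
    using less_linear by blast
qed

lemma add_subgroup_diff:
  "add_subgroup H \<Longrightarrow> x \<in> H \<Longrightarrow> y \<in> H \<Longrightarrow> x - y \<in> H"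
  unfolding add_subgroup_def by (metis diff_conv_add_uminus)

text \<open>Dividing \<open>a + b\<close> by two inside \<open>H\<close> gives a midpoint of
  \<open>a\<close> and \<open>b\<close>.\<close>

lemma divisible_subgroup_dense:
  fixes H :: "'a::linordered_ab_group_add set"
  assumes "add_subgroup H" "divisible_set H" "a \<in> H" "b \<in> H" "a < b"
  shows "\<exists>c\<in>H. a < c \<and> c < b"
proof -
  have "a + b \<in> H"
    using assms by (auto simp: add_subgroup_def)
  then obtain c where "c \<in> H" and "(\<Sum>i<(2::nat). c) = a + b"
    using \<open>divisible_set H\<close> unfolding divisible_set_def by (metis one_le_numeral)
  then have c: "c + c = a + b"
    by (simp add: numeral_2_eq_2)
  have "a < c"
  proof (rule ccontr)
    assume "\<not> a < c"
    then have "c + c < a + b"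
      using \<open>a < b\<close> by (intro add_le_less_mono) auto
    with c show False by simp
  qed
  moreover have "c < b"
  proof (rule ccontr)
    assume "\<not> c < b"
    then have "a + b < c + c"
      using \<open>a < b\<close> by (intro add_less_le_mono) auto
    with c show False by simp
  qed
  ultimately show ?thesis
    using \<open>c \<in> H\<close> by blast
qed

lemma divisible_subgroup_st_eq:
  fixes H :: "'a::linordered_ab_group_add set"
  assumes "add_subgroup H" "divisible_set H" "is_standard_part H b a"
  shows "st H b = a"
  unfolding st_def
  using assms is_standard_part_unique[OF divisible_subgroup_dense[OF assms(1,2)]]
  by (intro the_equality) auto

text \<open>Cofinality provides upper bounds; negating an upper bound of \<open>- b\<close> provides
  a lower bound of \<open>b\<close>.\<close>

lemma cofinal_subgroup_order_hull:
  fixes H :: "'a::linordered_ab_group_add set"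
  assumes "add_subgroup H" "cofinal_in H"
  shows "order_hull H = UNIV"
proof -
  have "b \<in> order_hull H" for b
  proof -
    obtain a2 where "a2 \<in> H" "b \<le> a2"
      using assms(2) unfolding cofinal_in_def by blast
    moreover obtain a1 where "a1 \<in> H" "- b \<le> a1"
      using assms(2) unfolding cofinal_in_def by blast
    moreover from this have "- a1 \<in> H" "- a1 \<le> b"
      using assms(1) by (auto simp: add_subgroup_def minus_le_iff)
    ultimately show ?thesis
      unfolding order_hull_def by blast
  qed
  then show ?thesis by auto
qed

text \<open>This justifies the definite description in \<open>st\<close>: tameness gives existence,
  density gives uniqueness.\<close>

lemma is_standard_part_st:
  fixes H :: "'a::linordered_ab_group_add set"
  assumes "add_subgroup H" "divisible_set H" "tame H" "cofinal_in H"
  shows "is_standard_part H b (st H b)"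
proof -
  obtain a where "is_standard_part H b a"
    using assms cofinal_subgroup_order_hull[of H] unfolding tame_def by auto
  with assms show ?thesis
    using divisible_subgroup_st_eq by metis
qed

lemma is_standard_part_uminus:
  fixes H :: "'a::linordered_ab_group_add set"
  assumes H: "add_subgroup H" and a: "is_standard_part H b a"
  shows "is_standard_part H (- b) (- a)"
  unfolding is_standard_part_iff
proof (intro conjI ballI)
  show "- a \<in> H"
    using H a by (auto simp: add_subgroup_def is_standard_part_iff)
next
  fix x assume "x \<in> H"
  then have "- x \<in> H"
    using H by (auto simp: add_subgroup_def)
  with a have "\<not> (b < - x \<and> - x < a)" "\<not> (a < - x \<and> - x < b)"
    by (auto simp: is_standard_part_iff)
  then show "\<not> (- b < x \<and> x < - a)" "\<not> (- a < x \<and> x < - b)"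
    by (metis minus_less_iff less_minus_iff)+
qed

text \<open>Translation by \<open>h\<close> preserves both \<open>H\<close> and the order. The case
  \<open>h = a\<close> moves the standard part to 0.\<close>

lemma is_standard_part_diff:
  fixes H :: "'a::linordered_ab_group_add set"
  assumes H: "add_subgroup H" and a: "is_standard_part H b a" and "h \<in> H"
  shows "is_standard_part H (b - h) (a - h)"
  unfolding is_standard_part_iff
proof (intro conjI ballI)
  show "a - h \<in> H"
    using assms by (auto simp: is_standard_part_iff add_subgroup_diff)
next
  fix x assume "x \<in> H"
  then have "x + h \<in> H"
    using H \<open>h \<in> H\<close> by (auto simp: add_subgroup_def)
  with a have "\<not> (b < x + h \<and> x + h < a)" "\<not> (a < x + h \<and> x + h < b)"
    by (auto simp: is_standard_part_iff)
  then show "\<not> (b - h < x \<and> x < a - h)" "\<not> (a - h < x \<and> x < b - h)"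
    by (auto simp: less_diff_eq diff_less_eq)
qed

lemma st_of_mem:
  fixes H :: "'a::linordered_ab_group_add set"
  assumes "\<delta> \<in> H" "add_subgroup H" "divisible_set H"
  shows "st H \<delta> = \<delta>"
  using assms by (intro divisible_subgroup_st_eq) (auto simp: is_standard_part_def)

section \<open>Homomorphisms of ordered groups and their restriction to a subgroup\<close>

lemma ogroup_hom_0:
  assumes "ogroup_hom UNIV UNIV f"
  shows "f 0 = 0"
proof -
  have "f (0 + 0) = f 0 + f 0"
    using assms unfolding ogroup_hom_def by blast
  then show ?thesis by simp
qed

lemma ogroup_hom_diff:
  assumes "ogroup_hom UNIV UNIV f"
  shows "f (x - y) = f x - f y"
proof -
  have "f (x - y + y) = f (x - y) + f y"
    using assms unfolding ogroup_hom_def by blast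
  then show ?thesis by (simp add: algebra_simps)
qed

lemma ogroup_hom_multiple:
  assumes "ogroup_hom UNIV UNIV f"
  shows "f (\<Sum>i<n::nat. y) = (\<Sum>i<n. f y)"
  using assms by (induction n) (auto simp: ogroup_hom_0, auto simp: ogroup_hom_def)

lemma ogroup_hom_mono:
  assumes "ogroup_hom UNIV UNIV f" "x \<le> y"
  shows "f x \<le> f y"
  using assms by (auto simp: ogroup_hom_def mono_on_def)

text \<open>A monotone bijection of linear orders has a monotone inverse, so condition (i) reduces
  to bijectivity.\<close>

lemma ogroup_iso_iff_bij_betw:
  fixes f :: "'g::linordered_ab_group_add \<Rightarrow> 'd::linordered_ab_group_add"
  assumes hom: "ogroup_hom UNIV UNIV f" and H: "add_subgroup H"
  shows "ogroup_iso H UNIV f \<longleftrightarrow> bij_betw f H UNIV"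
proof
  assume bij: "bij_betw f H UNIV"
  let ?g = "inv_into H f"
  have g: "?g d \<in> H" "f (?g d) = d" for d
    using bij by (auto simp: bij_betw_def f_inv_into_f inv_into_into)
  have inj: "x = y" if "x \<in> H" "y \<in> H" "f x = f y" for x y
    using bij that by (auto simp: bij_betw_def inj_on_def)
  \<comment> \<open>Both sides lie in \<open>H\<close> and have image \<open>x + y\<close> under
    \<open>f\<close>.\<close>
  have "?g (x + y) = ?g x + ?g y" for x y
    using g H hom by (intro inj) (auto simp: add_subgroup_def ogroup_hom_def)
  moreover have "?g x \<le> ?g y" if "x \<le> y" for x y
  proof (rule ccontr)
    assume "\<not> ?g x \<le> ?g y"
    then have "y \<le> x"
      using ogroup_hom_mono[OF hom, of "?g y" "?g x"] g by simp
    with that \<open>\<not> ?g x \<le> ?g y\<close> show False by simp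
  qed
  ultimately have "ogroup_hom UNIV H ?g"
    using g by (auto simp: ogroup_hom_def mono_on_def)
  moreover have "ogroup_hom H UNIV f"
    using hom by (auto simp: ogroup_hom_def mono_on_def)
  ultimately show "ogroup_iso H UNIV f"
    using bij by (auto simp: ogroup_iso_def)
qed (simp add: ogroup_iso_def)

text \<open>Divide the image in the codomain and pull the quotient back to \<open>H\<close>;
  injectivity turns equality of images into equality in \<open>H\<close>.\<close>

lemma bij_betw_divisible:
  fixes f :: "'g::linordered_ab_group_add \<Rightarrow> 'd::linordered_ab_group_add"
  assumes div: "divisible_set (UNIV :: 'd set)"
    and hom: "ogroup_hom UNIV UNIV f"
    and H: "add_subgroup H" and bij: "bij_betw f H UNIV"
  shows "divisible_set H"
  unfolding divisible_set_def
proof (intro allI impI ballI)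
  fix n :: nat and x assume "n \<ge> 1" "x \<in> H"
  then obtain d where "(\<Sum>i<n. d) = f x"
    using div unfolding divisible_set_def by blast
  moreover obtain y where y: "y \<in> H" "f y = d"
    using bij by (metis UNIV_I bij_betw_imp_surj_on image_iff)
  ultimately have "f (\<Sum>i<n. y) = f x"
    using ogroup_hom_multiple[OF hom] by simp
  moreover have "(\<Sum>i<n. y) \<in> H"
    using y H by (induction n) (auto simp: add_subgroup_def)
  ultimately have "(\<Sum>i<n. y) = x"
    using bij \<open>x \<in> H\<close> by (auto simp: bij_betw_def inj_on_def)
  with y show "\<exists>y\<in>H. (\<Sum>i<n. y) = x" by blast
qed

lemma bij_betw_cofinal:
  fixes f :: "'g::linordered_ab_group_add \<Rightarrow> 'd::linordered_ab_group_add"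
  assumes nontrivial: "\<exists>d::'d. d \<noteq> 0"
    and hom: "ogroup_hom UNIV UNIV f"
    and bij: "bij_betw f H UNIV"
  shows "cofinal_in H"
  unfolding cofinal_in_def
proof
  fix b
  obtain d :: 'd where "d > 0"
    using nontrivial by (metis neg_0_less_iff_less not_less_iff_gr_or_eq)
  \<comment> \<open>Since \<open>f\<close> is only weakly monotone, equal images would not order
    \<open>a\<close> and \<open>b\<close>; the positive shift \<open>d\<close> makes the image of
    \<open>a\<close> strictly larger.\<close>
  moreover obtain a where "a \<in> H" "f a = f b + d"
    using bij by (metis UNIV_I bij_betw_imp_surj_on image_iff)
  ultimately have "f b < f a" by simp
  then have "b \<le> a"
    using ogroup_hom_mono[OF hom, of a b] by force
  with \<open>a \<in> H\<close> show "\<exists>a\<in>H. b \<le> a" by blast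
qed

lemma bij_betw_is_standard_part:
  assumes hom: "ogroup_hom UNIV UNIV f" and bij: "bij_betw f H UNIV"
    and "a \<in> H" "f a = f b"
  shows "is_standard_part H b a"
  unfolding is_standard_part_iff
proof (intro conjI ballI)
  fix x assume "x \<in> H"
  \<comment> \<open>Monotonicity squeezes \<open>f x\<close> between the equal values
    \<open>f a\<close> and \<open>f b\<close>.\<close>
  have "f x = f a" if "b < x \<and> x < a \<or> a < x \<and> x < b"
    using that \<open>f a = f b\<close> ogroup_hom_mono[OF hom] by (metis order.antisym less_imp_le)
  then have "x = a" if "b < x \<and> x < a \<or> a < x \<and> x < b"
    using that bij \<open>x \<in> H\<close> \<open>a \<in> H\<close> by (auto simp: bij_betw_def inj_on_def)
  then show "\<not> (b < x \<and> x < a)" "\<not> (a < x \<and> x < b)"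
    by auto
qed fact

lemma kernel_st_imp_bij_betw:
  fixes f :: "'g::linordered_ab_group_add \<Rightarrow> 'd::linordered_ab_group_add"
  assumes hom: "ogroup_hom UNIV UNIV f" and surj: "surj f"
    and H: "add_subgroup H" "divisible_set H" "tame H" "cofinal_in H"
    and ker: "\<And>\<gamma>. f \<gamma> = 0 \<longleftrightarrow> st H \<gamma> = 0"
  shows "bij_betw f H UNIV"
proof -
  have "x = y" if "x \<in> H" "y \<in> H" "f x = f y" for x y
  proof -
    \<comment> \<open>The difference lies in the kernel, but as an element of \<open>H\<close> it is
      its own standard part.\<close>
    have "st H (x - y) = 0"
      using that ker ogroup_hom_diff[OF hom, of x y] by simp
    then show ?thesis
      using st_of_mem[OF add_subgroup_diff[OF H(1) that(1,2)] H(1,2)] by simp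
  qed
  moreover have "\<exists>a\<in>H. f a = d" for d
  proof -
    obtain b where b: "f b = d"
      using surj by (metis surjD)
    let ?a = "st H b"
    have std: "is_standard_part H b ?a"
      using H by (rule is_standard_part_st)
    then have "?a \<in> H"
      by (simp add: is_standard_part_def)
    then have "is_standard_part H (b - ?a) 0"
      using is_standard_part_diff[OF H(1) std \<open>?a \<in> H\<close>] by simp
    then have "f (b - ?a) = 0"
      using ker divisible_subgroup_st_eq[OF H(1,2)] by simp
    then have "f ?a = d"
      using b ogroup_hom_diff[OF hom] by simp
    with \<open>?a \<in> H\<close> show ?thesis by blast
  qed
  ultimately show ?thesis
    unfolding bij_betw_def inj_on_def by (metis UNIV_eq_I image_eqI)
qed

text \<open>An element is zero iff it and its negative are both nonnegative; \<open>f\<close> and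
  \<open>st H\<close> both commute with negation.\<close>

lemma sign_st_imp_kernel_st:
  fixes f :: "'g::linordered_ab_group_add \<Rightarrow> 'd::linordered_ab_group_add"
  assumes hom: "ogroup_hom UNIV UNIV f"
    and H: "add_subgroup H" "divisible_set H" "tame H" "cofinal_in H"
    and sign: "\<And>\<gamma>. f \<gamma> \<ge> 0 \<longleftrightarrow> st H \<gamma> \<ge> 0"
  shows "f \<gamma> = 0 \<longleftrightarrow> st H \<gamma> = 0"
proof -
  have "st H (- \<gamma>) = - st H \<gamma>"
    using is_standard_part_uminus[OF H(1) is_standard_part_st[OF H]]
    by (rule divisible_subgroup_st_eq[OF H(1,2)])
  moreover have "f (- \<gamma>) = - f \<gamma>"
    using ogroup_hom_diff[OF hom, of 0 \<gamma>] ogroup_hom_0[OF hom] by simp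
  ultimately show ?thesis
    using sign[of \<gamma>] sign[of "- \<gamma>"] by (auto intro: order.antisym)
qed

text \<open>By surjectivity the fibre of \<open>f\<close> through \<open>\<gamma>\<close> meets
  \<open>H\<close>. Any point of \<open>H\<close> in it is a standard part of
  \<open>\<gamma>\<close>, hence equals \<open>st H \<gamma>\<close>.\<close>

lemma bij_betw_st:
  fixes f :: "'g::linordered_ab_group_add \<Rightarrow> 'd::linordered_ab_group_add"
  assumes div: "divisible_set (UNIV :: 'd set)"
    and hom: "ogroup_hom UNIV UNIV f"
    and H: "add_subgroup H" and bij: "bij_betw f H UNIV"
  shows "\<delta> \<in> H \<and> f \<delta> = f \<gamma> \<longleftrightarrow> \<delta> = st H \<gamma>"
proof -
  have st: "st H \<gamma> = a" if "a \<in> H" "f a = f \<gamma>" for a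
    using divisible_subgroup_st_eq[OF H bij_betw_divisible[OF div hom H bij]]
      bij_betw_is_standard_part[OF hom bij that] by blast
  moreover obtain a where "a \<in> H" "f a = f \<gamma>"
    using bij by (metis UNIV_I bij_betw_imp_surj_on image_iff)
  ultimately show ?thesis by blast
qed

lemma bij_betw_tame:
  assumes hom: "ogroup_hom UNIV UNIV f" and bij: "bij_betw f H UNIV"
  shows "tame H"
  unfolding tame_def
proof
  fix b
  obtain a where "a \<in> H" "f a = f b"
    using bij by (metis UNIV_I bij_betw_imp_surj_on image_iff)
  then show "\<exists>a. is_standard_part H b a"
    using bij_betw_is_standard_part[OF hom bij] by blast
qed

section \<open>Equivalence of the three conditions, and the retraction\<close>

theorem theorem3p1:
  fixes f :: "'g::linordered_ab_group_add \<Rightarrow> 'd::linordered_ab_group_add"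
    and \<Delta>' :: "'g set"
  assumes div_\<Gamma>: "divisible_set (UNIV :: 'g set)"
    and div_\<Delta>: "divisible_set (UNIV :: 'd set)"
    and nontrivial_\<Delta>: "\<exists>d::'d. d \<noteq> 0"
    and hom: "ogroup_hom UNIV UNIV f"
    and surj: "surj f"
    and subgroup: "add_subgroup \<Delta>'"
  shows "let I = ogroup_iso \<Delta>' UNIV f;
             II = (divisible_set \<Delta>' \<and> tame \<Delta>' \<and> cofinal_in \<Delta>' \<and>
                   {\<gamma>. f \<gamma> = 0} = {\<gamma>. st \<Delta>' \<gamma> = 0});
             III = (divisible_set \<Delta>' \<and> tame \<Delta>' \<and> cofinal_in \<Delta>' \<and>
                    (\<forall>\<gamma>. f \<gamma> \<ge> 0 \<longleftrightarrow> st \<Delta>' \<gamma> \<ge> 0))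
         in (I \<longleftrightarrow> II) \<and> (II \<longleftrightarrow> III) \<and>
            (I \<longrightarrow> ogroup_hom UNIV UNIV (inv_into \<Delta>' f) \<and> inj (inv_into \<Delta>' f) \<and>
                   f \<circ> inv_into \<Delta>' f = id) \<and>
            (I \<or> II \<or> III \<longrightarrow>
               divisible_set \<Delta>' \<and> tame \<Delta>' \<and> cofinal_in \<Delta>' \<and>
               (\<forall>\<gamma> \<delta>. \<delta> \<in> \<Delta>' \<and> f \<delta> = f \<gamma> \<longleftrightarrow> \<delta> = st \<Delta>' \<gamma>) \<and>
               ogroup_hom UNIV \<Delta>' (st \<Delta>') \<and> range (st \<Delta>') = \<Delta>' \<and>
               (\<forall>\<delta>\<in>\<Delta>'. st \<Delta>' \<delta> = \<delta>))"

proof -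
  let ?H = \<Delta>'
  \<comment> \<open>\<open>B\<close> is the hub: each of (i), (ii) and (iii) is shown equivalent to
    it.\<close>
  define B where "B \<longleftrightarrow> bij_betw f ?H UNIV"
  define T where "T \<longleftrightarrow> divisible_set ?H \<and> tame ?H \<and> cofinal_in ?H"
  have iso: "ogroup_iso ?H UNIV f \<longleftrightarrow> B"
    unfolding B_def by (rule ogroup_iso_iff_bij_betw[OF hom subgroup])
  have T: T if B
    using that bij_betw_divisible[OF div_\<Delta> hom subgroup] bij_betw_tame[OF hom]
      bij_betw_cofinal[OF nontrivial_\<Delta> hom]
    unfolding B_def T_def by blast
  have st_iff: "\<delta> \<in> ?H \<and> f \<delta> = f \<gamma> \<longleftrightarrow> \<delta> = st ?H \<gamma>" if B for \<delta> \<gamma>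
    using that bij_betw_st[OF div_\<Delta> hom subgroup] unfolding B_def by blast
  have st_mem: "st ?H \<gamma> \<in> ?H" and f_st: "f (st ?H \<gamma>) = f \<gamma>" if B for \<gamma>
    using st_iff[OF that] by blast+
  \<comment> \<open>Comparing images rather than arguments serves twice: with \<open>x = 0\<close>
    it gives the sign condition, and with \<open>x \<le> y\<close> it gives monotonicity of the
    retraction.\<close>
  have st_mono: "st ?H x \<le> st ?H y" if B "f x \<le> f y" for x y
  proof (rule ccontr)
    assume "\<not> st ?H x \<le> st ?H y"
    then have "f y \<le> f x"
      using ogroup_hom_mono[OF hom, of "st ?H y" "st ?H x"] f_st[OF \<open>B\<close>] by simp
    with that have "f x = f y" by simp
    then have "st ?H x = st ?H y"
      using st_iff[OF \<open>B\<close>] by metis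
    with \<open>\<not> st ?H x \<le> st ?H y\<close> show False by simp
  qed
  have st_0: "st ?H 0 = 0" if B
    using st_iff[OF that, of 0 0] subgroup by (auto simp: add_subgroup_def)
  have sign: "f \<gamma> \<ge> 0 \<longleftrightarrow> st ?H \<gamma> \<ge> 0" if B for \<gamma>
    using st_mono[OF that, of 0 \<gamma>] ogroup_hom_mono[OF hom, of 0 "st ?H \<gamma>"]
      st_0[OF that] f_st[OF that, of \<gamma>] ogroup_hom_0[OF hom] by auto
  have kernel: "f \<gamma> = 0 \<longleftrightarrow> st ?H \<gamma> = 0"
    if T "\<And>\<gamma>. f \<gamma> \<ge> 0 \<longleftrightarrow> st ?H \<gamma> \<ge> 0" for \<gamma>
    using that sign_st_imp_kernel_st[OF hom subgroup] unfolding T_def by blast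
  have bij: B if T "\<And>\<gamma>. f \<gamma> = 0 \<longleftrightarrow> st ?H \<gamma> = 0"
    using that kernel_st_imp_bij_betw[OF hom surj subgroup] unfolding T_def B_def by blast
  have II: "divisible_set ?H \<and> tame ?H \<and> cofinal_in ?H \<and>
      {\<gamma>. f \<gamma> = 0} = {\<gamma>. st ?H \<gamma> = 0} \<longleftrightarrow> B" (is "?II \<longleftrightarrow> B")
  proof
    assume ?II
    then have "f \<gamma> = 0 \<longleftrightarrow> st ?H \<gamma> = 0" for \<gamma>
      by (auto simp: set_eq_iff)
    with \<open>?II\<close> show B
      using bij by (simp add: T_def)
  next
    assume B
    \<comment> \<open>The kernel condition is reached through the sign condition, which
      \<open>B\<close> implies.\<close>
    then have "f \<gamma> = 0 \<longleftrightarrow> st ?H \<gamma> = 0" for \<gamma>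
      using kernel T sign by blast
    with T[OF \<open>B\<close>] show ?II
      by (simp add: T_def)
  qed
  have III: "divisible_set ?H \<and> tame ?H \<and> cofinal_in ?H \<and>
      (\<forall>\<gamma>. f \<gamma> \<ge> 0 \<longleftrightarrow> st ?H \<gamma> \<ge> 0) \<longleftrightarrow> B" (is "?III \<longleftrightarrow> B")
  proof
    assume ?III
    then show B
      using bij kernel by (simp add: T_def)
  next
    assume B
    then show ?III
      using T sign by (simp add: T_def)
  qed
  have cross_section: "ogroup_hom UNIV UNIV (inv_into ?H f) \<and> inj (inv_into ?H f) \<and>
      f \<circ> inv_into ?H f = id" if B
  proof -
    have "ogroup_hom UNIV ?H (inv_into ?H f)"
      using that iso by (simp add: ogroup_iso_def)
    then have "ogroup_hom UNIV UNIV (inv_into ?H f)"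
      by (simp add: ogroup_hom_def)
    moreover have "f ` ?H = UNIV"
      using that by (simp add: B_def bij_betw_def)
    ultimately show ?thesis
      by (metis UNIV_I comp_apply ext f_inv_into_f id_apply inj_on_inv_into subset_UNIV subset_refl)
  qed
  have retract: "ogroup_hom UNIV ?H (st ?H) \<and> range (st ?H) = ?H \<and> (\<forall>\<delta>\<in>?H. st ?H \<delta> = \<delta>)" if B
  proof -
    have "st ?H \<delta> = \<delta>" if "\<delta> \<in> ?H" for \<delta>
      using st_iff[OF \<open>B\<close>, of \<delta> \<delta>] that by simp
    \<comment> \<open>The sum of the standard parts lies in the subgroup and in the fibre through
      \<open>x + y\<close>, so \<open>st_iff\<close> identifies it.\<close>
    moreover have "st ?H (x + y) = st ?H x + st ?H y" for x y
    proof -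
      have "st ?H x + st ?H y \<in> ?H"
        using subgroup st_mem[OF that] by (simp add: add_subgroup_def)
      moreover have "f (st ?H x + st ?H y) = f (x + y)"
        using hom f_st[OF that] by (simp add: ogroup_hom_def)
      ultimately show ?thesis
        using st_iff[OF that] by metis
    qed
    moreover have "st ?H x \<le> st ?H y" if "x \<le> y" for x y
      using st_mono[OF \<open>B\<close>] ogroup_hom_mono[OF hom that] by blast
    moreover have "range (st ?H) = ?H"
      using st_mem[OF that] calculation(1) by (metis image_subset_iff rangeI subsetI subset_antisym)
    ultimately show ?thesis
      by (simp add: ogroup_hom_def mono_on_def)
  qed
  show ?thesis
    unfolding Let_def iso II III
    using cross_section retract T st_iff by (simp add: T_def)
qed

end
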